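(* Let $G$ be a Lie group with Lie algebra $\mathfrak g$, $H\in\bigwedge^3\mathfrak g^*$ a closed left-invariant three-form, $g$ a left-invariant pseudo-Riemannian metric, $D^0$ the canonical divergence-free Levi-Civita generalized connection of $(G,H,\mathcal G_g)$ and $\delta\in E^*$. Let $S\in\Sigma_+\oplus\Sigma_-$ be an element of the generalized first prolongation such that the Levi-Civita generalized connection $D^0+S$ has divergence $\delta$. Then the Ricci curvatures $Ric^\pm_\delta$ of $(G,H,\mathcal G_g,\delta)$ are related to the Ricci curvatures $Ric^\pm_0$ of $(G,H,\mathcal G_g,0)$ by $$Ric^\pm_\delta=Ric^\pm_0+\mathrm{tr}_{E_\pm}(d^{D^0}S)^\pm=Ric^\pm_0-D^0\delta|_{E_\mp\otimes E_\pm}.$$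
   Context: Let $E=\mathfrak g\oplus\mathfrak g^*$, $n=\dim G$, with scalar product $\langle X+\xi,Y+\eta\rangle=\frac12(\xi(Y)+\eta(X))$ and Dorfman bracket $[X+\xi,Y+\eta]_H=[X,Y]-\mathrm{ad}_X^*\eta+\mathrm{ad}_Y^*\xi+H(X,Y,\cdot)$, where $\mathrm{ad}_X^*\eta=\eta\circ\mathrm{ad}_X$. Put $gX=g(X,\cdot)$, $\mathcal G_g(X+\xi,Y+\eta)=\frac12(g(X,Y)+g^{-1}(\xi,\eta))$ and $E_\pm=\{X\pm gX:X\in\mathfrak g\}$. A left-invariant generalized connection is an element $D\in E^*\otimes\mathfrak{so}(E)$, $u\mapsto D_u$. Its torsion is $T(u,v)=D_uv-D_vu-[u,v]_H+(Du)^*v$, where $Du$ is $w\mapsto D_wu$ and $*$ is the adjoint for $\langle\cdot,\cdot\rangle$. $D$ is Levi-Civita if $T=0$ and $D_uE_\pm\subset E_\pm$ for all $u$. Its divergence is $\delta_D(v)=\mathrm{tr}(u\mapsto D_uv)$. If $D$ is Levi-Civita with $\delta_D=\delta$, put $R(u,v)w=D_uD_vw-D_vD_uw-D_{[u,v]_H}w$ and, for $u_\pm\in E_\pm$, $Ric^+_\delta(u_-,u_+)=\mathrm{tr}(E_+\ni w\mapsto R(w,u_-)u_+\in E_+)$, $Ric^-_\delta(u_+,u_-)=\mathrm{tr}(E_-\ni w\mapsto R(w,u_+)u_-\in E_-)$; these are known to depend only on $\delta$, not on the choice of $D$. $\Sigma_\pm=\{\alpha\in E_\pm^*\otimes\mathfrak{so}(E_\pm):\langle\alpha_uv,w\rangle+\langle\alpha_vw,u\rangle+\langle\alpha_wu,v\rangle=0\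 \forall u,v,w\}$, regarded inside $E^*\otimes\mathfrak{so}(E)$ by extension by zero. $D^0$ is defined as follows: for a $g$-orthonormal basis $(v_a)$ of $\mathfrak g$ put $e_a=v_a+gv_a$, $e_{n+a}=v_a-gv_a$, $\mathcal B_{ABC}=\langle[e_A,e_B]_H,e_C\rangle$; then $\langle D^0_{e_A}e_B,e_C\rangle=\omega_{ABC}$ with $\omega_{abc}=\frac13\mathcal B_{abc}$, $\omega_{ijk}=\frac13\mathcal B_{ijk}$, $\omega_{ibc}=\mathcal B_{ibc}$, $\omega_{ajk}=\mathcal B_{ajk}$ ($a,b,c\le n<i,j,k$), all other components zero. It is a Levi-Civita generalized connection with zero divergence, independent of the basis. $(d^{D^0}S)(u,v)w=(D^0_u(S_v))w-(D^0_v(S_u))w-S_{[u,v]_H}w$, where $D^0_u(S_v)=[D^0_u,S_v]\in\mathrm{End}(E)$; $(d^{D^0}S)^\pm$ is its restriction to $E_\pm\otimes E_\mp\otimes E_\pm\to E_\pm$. For $\alpha\in E_\pm^*\otimes E_\mp^*\otimes E_\pm^*\otimes E_\pm$, $(\mathrm{tr}_{E_\pm}\alpha)(v,w)=\mathrm{tr}(E_\pm\ni u\mapsto\alpha(u,v)w)$ for $v\in E_\mp$, $w\in E_\pm$. Finally $(D^0\delta)(u,v)=(D^0_u\delta)(v)=-\delta(D^0_uv)$. *)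

theory Defs
  imports "HOL-Analysis.Analysis"
begin

section \<open>The dual space and the trace\<close>

typedef (overloaded) 'a covector = "{f :: 'a::real_vector \<Rightarrow> real. linear f}"
  morphisms pair_cov Covector
  by (auto intro!: exI[of _ "\<lambda>_. 0"] linearI)

lemma linear_pair_cov: "linear (pair_cov \<xi>)"
  using pair_cov by blast

lemma pair_cov_Covector: "linear f \<Longrightarrow> pair_cov (Covector f) = f"
  by (simp add: Covector_inverse)

lemma covector_eqI: "(\<And>x. pair_cov \<xi> x = pair_cov \<eta> x) \<Longrightarrow> \<xi> = \<eta>"
  by (metis ext pair_cov_inject)

instantiation covector :: (real_vector) real_vector
begin

definition "0 = Covector (\<lambda>_. 0)"
definition "\<xi> + \<eta> = Covector (\<lambda>x. pair_cov \<xi> x + pair_cov \<eta> x)"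
definition "- \<xi> = Covector (\<lambda>x. - pair_cov \<xi> x)"
definition "\<xi> - \<eta> = Covector (\<lambda>x. pair_cov \<xi> x - pair_cov \<eta> x)"
definition "c *\<^sub>R \<xi> = Covector (\<lambda>x. c * pair_cov \<xi> x)"

lemma pair_cov_simps [simp]:
  "pair_cov 0 x = 0"
  "pair_cov (\<xi> + \<eta>) x = pair_cov \<xi> x + pair_cov \<eta> x"
  "pair_cov (- \<xi>) x = - pair_cov \<xi> x"
  "pair_cov (\<xi> - \<eta>) x = pair_cov \<xi> x - pair_cov \<eta> x"
  "pair_cov (c *\<^sub>R \<xi>) x = c * pair_cov \<xi> x"
  unfolding zero_covector_def plus_covector_def uminus_covector_def minus_covector_def
    scaleR_covector_def
  by (subst pair_cov_Covector;
      auto intro!: linearI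
        simp: linear_add[OF linear_pair_cov] linear_scale[OF linear_pair_cov] algebra_simps)+

instance
  by standard (rule covector_eqI, simp add: algebra_simps)+

end

text \<open>
  Trace of an endomorphism \<open>f\<close> of a finite-dimensional subspace \<open>V\<close>, computed in an arbitrary
  basis of \<open>V\<close>; meaningful when \<open>f\<close> is linear and maps \<open>V\<close> to \<open>V\<close>.
\<close>

definition trace_on :: "'e::real_vector set \<Rightarrow> ('e \<Rightarrow> 'e) \<Rightarrow> real" where
  "trace_on V f =
    (let B = (SOME B. independent B \<and> span B = V) in \<Sum>b\<in>B. representation B (f b) b)"


section \<open>Lie algebra data\<close>

text \<open>
  Every tensor field on the Lie group is left-invariant and is represented by its value on the
  Lie algebra, a real vector space \<open>'a\<close> with bracket \<open>br\<close>; the group itself does not occur.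
\<close>

definition finite_dimensional :: "'a::real_vector itself \<Rightarrow> bool" where
  "finite_dimensional _ \<longleftrightarrow> (\<exists>B :: 'a set. finite B \<and> span B = UNIV)"

definition lie_algebra :: "('a::real_vector \<Rightarrow> 'a \<Rightarrow> 'a) \<Rightarrow> bool" where
  "lie_algebra br \<longleftrightarrow> bilinear br \<and> (\<forall>x. br x x = 0) \<and>
    (\<forall>x y z. br x (br y z) + br y (br z x) + br z (br x y) = 0)"

definition three_form :: "('a::real_vector \<Rightarrow> 'a \<Rightarrow> 'a \<Rightarrow> real) \<Rightarrow> bool" where
  "three_form H \<longleftrightarrow>
    (\<forall>y z. linear (\<lambda>x. H x y z)) \<and> (\<forall>x z. linear (\<lambda>y. H x y z)) \<and> (\<forall>x y. linear (\<lambda>z. H x y z)) \<and>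
    (\<forall>x y. H x x y = 0 \<and> H x y y = 0 \<and> H x y x = 0)"

text \<open>
  The exterior derivative of a left-invariant three-form, evaluated on left-invariant vector
  fields: in the Koszul formula only the bracket terms survive.
\<close>

definition closed_form3 ::
    "('a::real_vector \<Rightarrow> 'a \<Rightarrow> 'a) \<Rightarrow> ('a \<Rightarrow> 'a \<Rightarrow> 'a \<Rightarrow> real) \<Rightarrow> bool" where
  "closed_form3 br H \<longleftrightarrow> (\<forall>x y z w.
     - H (br x y) z w + H (br x z) y w - H (br x w) y z
     - H (br y z) x w + H (br y w) x z - H (br z w) x y = 0)"

definition pseudo_metric :: "('a::real_vector \<Rightarrow> 'a \<Rightarrow> real) \<Rightarrow> bool" where
  "pseudo_metric g \<longleftrightarrow> bilinear g \<and> (\<forall>x y. g x y = g y x) \<and> (\<forall>x. (\<forall>y. g x y = 0) \<longrightarrow> x = 0)"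


section \<open>The generalized tangent space\<close>

type_synonym 'a gspace = "'a \<times> 'a covector"

definition gpair :: "'a::real_vector gspace \<Rightarrow> 'a gspace \<Rightarrow> real" where
  "gpair u v = (pair_cov (snd u) (fst v) + pair_cov (snd v) (fst u)) / 2"

definition coad :: "('a::real_vector \<Rightarrow> 'a \<Rightarrow> 'a) \<Rightarrow> 'a \<Rightarrow> 'a covector \<Rightarrow> 'a covector" where
  "coad br X \<eta> = Covector (\<lambda>Z. pair_cov \<eta> (br X Z))"

definition dorfman :: "('a::real_vector \<Rightarrow> 'a \<Rightarrow> 'a) \<Rightarrow> ('a \<Rightarrow> 'a \<Rightarrow> 'a \<Rightarrow> real) \<Rightarrow>
    'a gspace \<Rightarrow> 'a gspace \<Rightarrow> 'a gspace" where
  "dorfman br H u v =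
    (br (fst u) (fst v),
     - coad br (fst u) (snd v) + coad br (fst v) (snd u) + Covector (\<lambda>Z. H (fst u) (fst v) Z))"

definition flat :: "('a::real_vector \<Rightarrow> 'a \<Rightarrow> real) \<Rightarrow> 'a \<Rightarrow> 'a covector" where
  "flat g X = Covector (\<lambda>Y. g X Y)"

definition E_plus :: "('a::real_vector \<Rightarrow> 'a \<Rightarrow> real) \<Rightarrow> 'a gspace set" where
  "E_plus g = {(X, flat g X) | X. True}"

definition E_minus :: "('a::real_vector \<Rightarrow> 'a \<Rightarrow> real) \<Rightarrow> 'a gspace set" where
  "E_minus g = {(X, - flat g X) | X. True}"


section \<open>Generalized connections\<close>

definition gen_connection ::
    "('a::real_vector gspace \<Rightarrow> 'a gspace \<Rightarrow> 'a gspace) \<Rightarrow> bool" where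
  "gen_connection D \<longleftrightarrow> bilinear D \<and> (\<forall>u v w. gpair (D u v) w + gpair v (D u w) = 0)"

definition gadjoint ::
    "('a::real_vector gspace \<Rightarrow> 'a gspace) \<Rightarrow> 'a gspace \<Rightarrow> 'a gspace" where
  "gadjoint A = (SOME A'. \<forall>x y. gpair (A x) y = gpair x (A' y))"

definition torsion :: "('a::real_vector \<Rightarrow> 'a \<Rightarrow> 'a) \<Rightarrow> ('a \<Rightarrow> 'a \<Rightarrow> 'a \<Rightarrow> real) \<Rightarrow>
    ('a gspace \<Rightarrow> 'a gspace \<Rightarrow> 'a gspace) \<Rightarrow> 'a gspace \<Rightarrow> 'a gspace \<Rightarrow> 'a gspace" where
  "torsion br H D u v = D u v - D v u - dorfman br H u v + gadjoint (\<lambda>w. D w u) v"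

definition levi_civita :: "('a::real_vector \<Rightarrow> 'a \<Rightarrow> 'a) \<Rightarrow> ('a \<Rightarrow> 'a \<Rightarrow> 'a \<Rightarrow> real) \<Rightarrow>
    ('a \<Rightarrow> 'a \<Rightarrow> real) \<Rightarrow> ('a gspace \<Rightarrow> 'a gspace \<Rightarrow> 'a gspace) \<Rightarrow> bool" where
  "levi_civita br H g D \<longleftrightarrow> gen_connection D \<and>
    (\<forall>u v. torsion br H D u v = 0) \<and>
    (\<forall>u. D u ` E_plus g \<subseteq> E_plus g) \<and> (\<forall>u. D u ` E_minus g \<subseteq> E_minus g)"

definition divergence ::
    "('a::real_vector gspace \<Rightarrow> 'a gspace \<Rightarrow> 'a gspace) \<Rightarrow> 'a gspace \<Rightarrow> real" where
  "divergence D v = trace_on UNIV (\<lambda>u. D u v)"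

definition curvature :: "('a::real_vector \<Rightarrow> 'a \<Rightarrow> 'a) \<Rightarrow> ('a \<Rightarrow> 'a \<Rightarrow> 'a \<Rightarrow> real) \<Rightarrow>
    ('a gspace \<Rightarrow> 'a gspace \<Rightarrow> 'a gspace) \<Rightarrow>
    'a gspace \<Rightarrow> 'a gspace \<Rightarrow> 'a gspace \<Rightarrow> 'a gspace" where
  "curvature br H D u v w = D u (D v w) - D v (D u w) - D (dorfman br H u v) w"

text \<open>
  The Ricci curvatures are those of any Levi-Civita generalized connection with
  divergence \<open>\<delta>\<close>; the values below are independent of the connection selected.
\<close>

definition lc_with_div :: "('a::real_vector \<Rightarrow> 'a \<Rightarrow> 'a) \<Rightarrow> ('a \<Rightarrow> 'a \<Rightarrow> 'a \<Rightarrow> real) \<Rightarrow>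
    ('a \<Rightarrow> 'a \<Rightarrow> real) \<Rightarrow> ('a gspace \<Rightarrow> real) \<Rightarrow> 'a gspace \<Rightarrow> 'a gspace \<Rightarrow> 'a gspace" where
  "lc_with_div br H g \<delta> = (SOME D. levi_civita br H g D \<and> divergence D = \<delta>)"

definition Ric_plus :: "('a::real_vector \<Rightarrow> 'a \<Rightarrow> 'a) \<Rightarrow> ('a \<Rightarrow> 'a \<Rightarrow> 'a \<Rightarrow> real) \<Rightarrow>
    ('a \<Rightarrow> 'a \<Rightarrow> real) \<Rightarrow> ('a gspace \<Rightarrow> real) \<Rightarrow> 'a gspace \<Rightarrow> 'a gspace \<Rightarrow> real" where
  "Ric_plus br H g \<delta> u v =
    trace_on (E_plus g) (\<lambda>w. curvature br H (lc_with_div br H g \<delta>) w u v)"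

definition Ric_minus :: "('a::real_vector \<Rightarrow> 'a \<Rightarrow> 'a) \<Rightarrow> ('a \<Rightarrow> 'a \<Rightarrow> 'a \<Rightarrow> real) \<Rightarrow>
    ('a \<Rightarrow> 'a \<Rightarrow> real) \<Rightarrow> ('a gspace \<Rightarrow> real) \<Rightarrow> 'a gspace \<Rightarrow> 'a gspace \<Rightarrow> real" where
  "Ric_minus br H g \<delta> u v =
    trace_on (E_minus g) (\<lambda>w. curvature br H (lc_with_div br H g \<delta>) w u v)"


section \<open>The generalized first prolongation\<close>

text \<open>
  For complementary subspaces \<open>V\<close> and \<open>W\<close>: the elements of \<open>V\<^sup>* \<otimes> so(V)\<close> with vanishing
  cyclic sum, extended by zero on \<open>W\<close>.
\<close>

definition prolongation_on :: "'a::real_vector gspace set \<Rightarrow> 'a gspace set \<Rightarrow>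
    ('a gspace \<Rightarrow> 'a gspace \<Rightarrow> 'a gspace) set" where
  "prolongation_on V W = {\<alpha>. bilinear \<alpha> \<and>
    (\<forall>u\<in>V. \<forall>v\<in>V. \<alpha> u v \<in> V) \<and>
    (\<forall>u\<in>W. \<forall>v. \<alpha> u v = 0) \<and> (\<forall>u. \<forall>v\<in>W. \<alpha> u v = 0) \<and>
    (\<forall>u\<in>V. \<forall>v\<in>V. \<forall>w\<in>V. gpair (\<alpha> u v) w + gpair v (\<alpha> u w) = 0) \<and>
    (\<forall>u\<in>V. \<forall>v\<in>V. \<forall>w\<in>V. gpair (\<alpha> u v) w + gpair (\<alpha> v w) u + gpair (\<alpha> w u) v = 0)}"

definition gen_prolongation :: "('a::real_vector \<Rightarrow> 'a \<Rightarrow> real) \<Rightarrow>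
    ('a gspace \<Rightarrow> 'a gspace \<Rightarrow> 'a gspace) set" where
  "gen_prolongation g = {\<lambda>u v. \<alpha> u v + \<beta> u v | \<alpha> \<beta>.
    \<alpha> \<in> prolongation_on (E_plus g) (E_minus g) \<and> \<beta> \<in> prolongation_on (E_minus g) (E_plus g)}"

definition d_conn :: "('a::real_vector \<Rightarrow> 'a \<Rightarrow> 'a) \<Rightarrow> ('a \<Rightarrow> 'a \<Rightarrow> 'a \<Rightarrow> real) \<Rightarrow>
    ('a gspace \<Rightarrow> 'a gspace \<Rightarrow> 'a gspace) \<Rightarrow> ('a gspace \<Rightarrow> 'a gspace \<Rightarrow> 'a gspace) \<Rightarrow>
    'a gspace \<Rightarrow> 'a gspace \<Rightarrow> 'a gspace \<Rightarrow> 'a gspace" where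
  "d_conn br H D S u v w =
    (D u (S v w) - S v (D u w)) - (D v (S u w) - S u (D v w)) - S (dorfman br H u v) w"

definition cov_deriv_form :: "('a::real_vector gspace \<Rightarrow> 'a gspace \<Rightarrow> 'a gspace) \<Rightarrow>
    ('a gspace \<Rightarrow> real) \<Rightarrow> 'a gspace \<Rightarrow> 'a gspace \<Rightarrow> real" where
  "cov_deriv_form D \<delta> u v = - \<delta> (D u v)"


section \<open>The canonical divergence-free Levi-Civita generalized connection\<close>

definition orthonormal_basis :: "('a::real_vector \<Rightarrow> 'a \<Rightarrow> real) \<Rightarrow> 'a set \<Rightarrow> bool" where
  "orthonormal_basis g B \<longleftrightarrow> independent B \<and> span B = UNIV \<and>
    (\<forall>x\<in>B. g x x = 1 \<or> g x x = -1) \<and> (\<forall>x\<in>B. \<forall>y\<in>B. x \<noteq> y \<longrightarrow> g x y = 0)"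

text \<open>
  The frame is indexed by its own (pairwise distinct) elements: \<open>P\<close> and \<open>M\<close> are the sets of
  the \<open>e\<^sub>a\<close> and of the \<open>e\<^sub>i\<close>, and \<open>\<omega>\<close> is evaluated on frame elements instead of indices.
\<close>

definition canonical_coeff :: "('a::real_vector \<Rightarrow> 'a \<Rightarrow> 'a) \<Rightarrow> ('a \<Rightarrow> 'a \<Rightarrow> 'a \<Rightarrow> real) \<Rightarrow>
    'a gspace set \<Rightarrow> 'a gspace set \<Rightarrow> 'a gspace \<Rightarrow> 'a gspace \<Rightarrow> 'a gspace \<Rightarrow> real" where
  "canonical_coeff br H P M a b c =
    (if a \<in> P \<and> b \<in> P \<and> c \<in> P \<or> a \<in> M \<and> b \<in> M \<and> c \<in> M then gpair (dorfman br H a b) c / 3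
     else if a \<in> M \<and> b \<in> P \<and> c \<in> P \<or> a \<in> P \<and> b \<in> M \<and> c \<in> M then gpair (dorfman br H a b) c
     else 0)"

definition canonical_connection :: "('a::real_vector \<Rightarrow> 'a \<Rightarrow> 'a) \<Rightarrow>
    ('a \<Rightarrow> 'a \<Rightarrow> 'a \<Rightarrow> real) \<Rightarrow> ('a \<Rightarrow> 'a \<Rightarrow> real) \<Rightarrow>
    ('a gspace \<Rightarrow> 'a gspace \<Rightarrow> 'a gspace) \<Rightarrow> bool" where
  "canonical_connection br H g D \<longleftrightarrow> bilinear D \<and>
    (\<exists>B. orthonormal_basis g B \<and>
      (let P = (\<lambda>v. (v, flat g v)) ` B; M = (\<lambda>v. (v, - flat g v)) ` B in
        \<forall>a\<in>P \<union> M. \<forall>b\<in>P \<union> M. \<forall>c\<in>P \<union> M.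
          gpair (D a b) c = canonical_coeff br H P M a b c))"

end

theory Submission
  imports Defs
begin

text \<open>
  Two Levi-Civita generalized connections differ by a tensor \<open>T\<close> that vanishes on mixed arguments
  from \<open>E\<^sub>+\<close> and \<open>E\<^sub>-\<close>: in the torsion identity
  \<open>\<langle>T\<^sub>uv, w\<rangle> - \<langle>T\<^sub>vu, w\<rangle> + \<langle>T\<^sub>wu, v\<rangle> = 0\<close> only the first term survives for \<open>u \<in> E\<^sub>-\<close>,
  \<open>v, w \<in> E\<^sub>+\<close>. Hence on mixed arguments the quadratic term \<open>[T\<^sub>w, T\<^sub>u]\<close> of the curvature of
  \<open>D + T\<close> disappears. As \<open>[w, u]\<^sub>H = D\<^sub>wu - D\<^sub>uw\<close> for \<open>w \<in> E\<^sub>+\<close>, \<open>u \<in> E\<^sub>-\<close>, the remaining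
  linear term is \<open>T\<^sub>w(D\<^sub>uv) + (T\<^bsub>D\<^sub>uw\<^esub>v - D\<^sub>u(T\<^sub>wv))\<close>. The bracket is a commutator of
  endomorphisms in \<open>w\<close> and has trace zero; the rest has trace \<open>\<delta>\<^sub>T(D\<^sub>uv)\<close>, the divergence of \<open>T\<close>.
\<close>

section \<open>Orthogonal splittings of the generalized tangent space\<close>

lemma bilinear_linear_left: "bilinear h \<Longrightarrow> linear (\<lambda>x. h x y)"
  by (simp add: bilinear_def)

lemma bilinear_linear_right: "bilinear h \<Longrightarrow> linear (h x)"
  by (simp add: bilinear_def)

lemma gpair_sym: "gpair u v = gpair v u"
  by (simp add: gpair_def)

lemma linear_gpair: "linear (gpair u)"
  by (rule linearI) (simp_all add: gpair_def linear_add[OF linear_pair_cov]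
      linear_scale[OF linear_pair_cov] algebra_simps add_divide_distrib)

lemmas gpair_right =
  linear_0[OF linear_gpair] linear_add[OF linear_gpair] linear_diff[OF linear_gpair]
  linear_neg[OF linear_gpair] linear_scale[OF linear_gpair] linear_sum[OF linear_gpair]

lemma linear_gpair_left: "linear (\<lambda>u. gpair u v)"
  by (subst gpair_sym) (rule linear_gpair)

lemmas gpair_left =
  linear_0[OF linear_gpair_left] linear_add[OF linear_gpair_left]
  linear_diff[OF linear_gpair_left] linear_neg[OF linear_gpair_left]
  linear_scale[OF linear_gpair_left] linear_sum[OF linear_gpair_left]

lemma linear_gpair_comp:
  assumes "linear f"
  shows "linear (\<lambda>x. gpair (f x) w)" and "linear (\<lambda>x. gpair w (f x))"
  using linear_compose[OF assms linear_gpair[of w]] by (simp_all add: o_def gpair_sym[of _ w])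

text \<open>Reduces the tensor identities below to checks on frame elements. The slots have separate
  spanning sets so that an identity can be restricted to, say, second arguments in E_+ and third
  ones in E_-.\<close>

lemma trilinear_eq_0_on_span:
  assumes "\<And>y z. linear (\<lambda>x. f x y z)" and "\<And>x z. linear (\<lambda>y. f x y z)"
    and "\<And>x y. linear (f x y)"
    and zero: "\<And>a b c. a \<in> A \<Longrightarrow> b \<in> B \<Longrightarrow> c \<in> C \<Longrightarrow> f a b c = 0"
    and "x \<in> span A" and "y \<in> span B" and "z \<in> span C"
  shows "f x y z = 0"
proof -
  have 1: "f a b z = 0" if "a \<in> A" "b \<in> B" for a b
    by (rule real_vector.linear_eq_0_on_span[OF assms(3) _ assms(7)]) (use zero that in blast)
  have 2: "f a y z = 0" if "a \<in> A" for a
    by (rule real_vector.linear_eq_0_on_span[OF assms(2) _ assms(6)]) (use 1 that in blast)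
  show ?thesis
    by (rule real_vector.linear_eq_0_on_span[OF assms(1) _ assms(5)]) (use 2 in blast)
qed

section \<open>Traces on finite-dimensional subspaces\<close>

text \<open>Expanding \<open>b\<close> in \<open>C\<close> on the left and \<open>f c\<close> in
  \<open>B\<close> on the right produces the same double sum of
  \<open>representation C b c * representation B (f c) b\<close>.\<close>

lemma basis_trace_eq:
  assumes B: "finite B" "independent B" "span B = V"
    and C: "finite C" "independent C" "span C = V"
    and f: "linear f" "\<And>x. x \<in> V \<Longrightarrow> f x \<in> V"
  shows "(\<Sum>b\<in>B. representation B (f b) b) = (\<Sum>c\<in>C. representation C (f c) c)"
proof -
  have BV: "b \<in> V" if "b \<in> B" for b using that B(3) span_base by blast
  have CV: "c \<in> V" if "c \<in> C" for c using that C(3) span_base by blast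
  have fB: "f c \<in> span B" if "c \<in> C" for c using f(2) CV B(3) that by simp
  have BC: "b \<in> span C" if "b \<in> B" for b using BV C(3) that by simp
  have "representation B (f b) b = (\<Sum>c\<in>C. representation C b c * representation B (f c) b)"
    if "b \<in> B" for b
  proof -
    have "f b = f (\<Sum>c\<in>C. representation C b c *\<^sub>R c)"
      using sum_representation_eq[OF C(2) _ C(1)] BV that C(3) by simp
    also have "\<dots> = (\<Sum>c\<in>C. representation C b c *\<^sub>R f c)"
      by (simp add: linear_sum[OF f(1)] linear_scale[OF f(1)])
    finally show ?thesis
      using fB
      by (simp add: representation_sum[OF B(2)] representation_scale[OF B(2)] span_scale)
  qed
  moreover have "representation C (f c) c
      = (\<Sum>b\<in>B. representation C b c * representation B (f c) b)" if "c \<in> C" for c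
  proof -
    have "f c = (\<Sum>b\<in>B. representation B (f c) b *\<^sub>R b)"
      using sum_representation_eq[OF B(2) _ B(1)] CV f(2) that B(3) by simp
    then have "representation C (f c) c
        = representation C (\<Sum>b\<in>B. representation B (f c) b *\<^sub>R b) c" by simp
    also have "\<dots> = (\<Sum>b\<in>B. representation C b c * representation B (f c) b)"
      using BC
      by (simp add: representation_sum[OF C(2)] representation_scale[OF C(2)] span_scale mult.commute)
    finally show ?thesis .
  qed
  ultimately show ?thesis
    by (simp add: sum.swap[of _ B C])
qed

text \<open>The basis behind \<open>trace_on\<close> is finite, being independent inside the span of
  the finite set \<open>B\<close>; hence \<open>B\<close> may replace it.\<close>

lemma trace_on_eq:
  assumes B: "finite B" "independent B" "span B = V"
    and f: "linear f" "\<And>x. x \<in> V \<Longrightarrow> f x \<in> V"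
  shows "trace_on V f = (\<Sum>b\<in>B. representation B (f b) b)"
proof -
  let ?C = "SOME B. independent B \<and> span B = V"
  have C: "independent ?C \<and> span ?C = V"
    by (rule someI_ex) (use B in blast)
  then have "finite ?C"
    using independent_span_bound[OF B(1), of ?C] B(3) span_superset[of ?C] by simp
  with C B f show ?thesis
    unfolding trace_on_def Let_def by (intro basis_trace_eq) auto
qed

text \<open>Works in the one basis selected by \<open>trace_on\<close>, where
  \<open>representation\<close> is additive on \<open>V\<close>; \<open>B\<close> witnesses that
  there is a basis to select.\<close>

lemma trace_on_add:
  assumes "independent B" "span B = V"
    and "\<And>x. x \<in> V \<Longrightarrow> f x \<in> V" "\<And>x. x \<in> V \<Longrightarrow> h x \<in> V"
  shows "trace_on V (\<lambda>x. f x + h x) = trace_on V f + trace_on V h"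
proof -
  let ?C = "SOME B. independent B \<and> span B = V"
  have C: "independent ?C \<and> span ?C = V"
    by (rule someI_ex) (use assms in blast)
  then have "b \<in> V" if "b \<in> ?C" for b using that span_base by blast
  then show ?thesis
    using C assms unfolding trace_on_def Let_def
    by (simp add: representation_add sum.distrib)
qed

lemma trace_on_cong:
  assumes "independent B" "span B = V" and "\<And>x. x \<in> V \<Longrightarrow> f x = h x"
  shows "trace_on V f = trace_on V h"
proof -
  let ?C = "SOME B. independent B \<and> span B = V"
  have C: "independent ?C \<and> span ?C = V"
    by (rule someI_ex) (use assms in blast)
  then have "b \<in> V" if "b \<in> ?C" for b using that span_base by blast
  then show ?thesis
    using assms(3) unfolding trace_on_def Let_def by simp
qed

text \<open>The pairing has neutral signature, so positive norms are replaced by non-zero ones. The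
  vectors are not normalised; coefficients below therefore carry the divisor
  \<open>gpair y y\<close>.\<close>

definition orthogonal_frame :: "'a::real_vector gspace set \<Rightarrow> bool" where
  "orthogonal_frame F \<longleftrightarrow> finite F \<and> (\<forall>x\<in>F. gpair x x \<noteq> 0) \<and>
    (\<forall>x\<in>F. \<forall>y\<in>F. x \<noteq> y \<longrightarrow> gpair x y = 0)"

lemma orthogonal_frame_subset: "orthogonal_frame F \<Longrightarrow> P \<subseteq> F \<Longrightarrow> orthogonal_frame P"
  unfolding orthogonal_frame_def by (meson finite_subset subsetD)

lemma orthogonal_frame_sum:
  assumes "orthogonal_frame F" "y \<in> F"
  shows "gpair (\<Sum>x\<in>F. c x *\<^sub>R x) y = c y * gpair y y"
proof -
  have "gpair (\<Sum>x\<in>F. c x *\<^sub>R x) y = (\<Sum>x\<in>F. c x * gpair x y)"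
    by (simp add: gpair_left)
  also have "\<dots> = (\<Sum>x\<in>F. if x = y then c y * gpair y y else 0)"
    using assms by (intro sum.cong) (auto simp: orthogonal_frame_def)
  finally show ?thesis
    using assms by (simp add: orthogonal_frame_def)
qed

lemma orthogonal_frame_independent:
  assumes "orthogonal_frame F"
  shows "independent F"
proof (rule independent_if_scalars_zero)
  show "finite F" using assms by (simp add: orthogonal_frame_def)
  fix c y assume "(\<Sum>x\<in>F. c x *\<^sub>R x) = 0" "y \<in> F"
  with orthogonal_frame_sum[OF assms, of y c] show "c y = 0"
    using assms by (simp add: gpair_left orthogonal_frame_def)
qed

lemma orthogonal_frame_representation:
  assumes F: "orthogonal_frame F" and "x \<in> span F" "y \<in> F"
  shows "representation F x y = gpair x y / gpair y y"
proof -
  have "x = (\<Sum>e\<in>F. representation F x e *\<^sub>R e)"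
    using sum_representation_eq[OF orthogonal_frame_independent[OF F] \<open>x \<in> span F\<close>, of F] F
    by (simp add: orthogonal_frame_def)
  then have "gpair x y = representation F x y * gpair y y"
    using orthogonal_frame_sum[OF F \<open>y \<in> F\<close>, of "representation F x"] by simp
  then show ?thesis using F \<open>y \<in> F\<close> by (simp add: orthogonal_frame_def)
qed

lemma orthogonal_frame_expansion:
  assumes F: "orthogonal_frame F" and "x \<in> span F"
  shows "x = (\<Sum>y\<in>F. (gpair x y / gpair y y) *\<^sub>R y)"
proof -
  have "x = (\<Sum>y\<in>F. representation F x y *\<^sub>R y)"
    using sum_representation_eq[OF orthogonal_frame_independent[OF F] \<open>x \<in> span F\<close>, of F] F
    by (simp add: orthogonal_frame_def)
  also have "\<dots> = (\<Sum>y\<in>F. (gpair x y / gpair y y) *\<^sub>R y)"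
    using orthogonal_frame_representation[OF F \<open>x \<in> span F\<close>] by (intro sum.cong) auto
  finally show ?thesis .
qed

lemma trace_on_orthogonal_frame:
  assumes F: "orthogonal_frame F"
    and f: "linear f" "\<And>x. x \<in> span F \<Longrightarrow> f x \<in> span F"
  shows "trace_on (span F) f = (\<Sum>y\<in>F. gpair (f y) y / gpair y y)"
proof -
  have "finite F" using F by (simp add: orthogonal_frame_def)
  then have "trace_on (span F) f = (\<Sum>y\<in>F. representation F (f y) y)"
    by (rule trace_on_eq[OF _ orthogonal_frame_independent[OF F] refl f])
  also have "\<dots> = (\<Sum>y\<in>F. gpair (f y) y / gpair y y)"
    by (intro sum.cong refl orthogonal_frame_representation[OF F f(2)[OF span_base]])
  finally show ?thesis .
qed

text \<open>Expanding \<open>h y\<close> in the frame turns the trace of the composite into a double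
  sum of products of matrix entries; exchanging the summations exchanges \<open>f\<close> and
  \<open>h\<close>.\<close>

lemma trace_on_commute:
  assumes F: "orthogonal_frame F"
    and f: "linear f" "\<And>x. x \<in> span F \<Longrightarrow> f x \<in> span F"
    and h: "linear h" "\<And>x. x \<in> span F \<Longrightarrow> h x \<in> span F"
  shows "trace_on (span F) (\<lambda>x. f (h x)) = trace_on (span F) (\<lambda>x. h (f x))"
proof -
  have expand: "trace_on (span F) (\<lambda>x. f (h x))
      = (\<Sum>y\<in>F. \<Sum>z\<in>F. (gpair (h y) z / gpair z z) * (gpair (f z) y / gpair y y))"
    if f: "linear f" "\<And>x. x \<in> span F \<Longrightarrow> f x \<in> span F"
      and h: "linear h" "\<And>x. x \<in> span F \<Longrightarrow> h x \<in> span F" for f h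
  proof -
    have "f (h y) = (\<Sum>z\<in>F. (gpair (h y) z / gpair z z) *\<^sub>R f z)" if "y \<in> F" for y
      by (subst orthogonal_frame_expansion[OF F h(2)[OF span_base[OF that]]])
        (simp add: linear_sum[OF f(1)] linear_scale[OF f(1)])
    then show ?thesis
      using trace_on_orthogonal_frame[OF F linear_compose[OF h(1) f(1)]] f(2) h(2)
      by (simp add: o_def gpair_left sum_divide_distrib)
  qed
  have "trace_on (span F) (\<lambda>x. f (h x))
      = (\<Sum>y\<in>F. \<Sum>z\<in>F. (gpair (h y) z / gpair z z) * (gpair (f z) y / gpair y y))"
    using f h by (rule expand)
  also have "\<dots> = (\<Sum>z\<in>F. \<Sum>y\<in>F. (gpair (f z) y / gpair y y) * (gpair (h y) z / gpair z z))"
    by (subst sum.swap) (simp add: mult.commute)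
  also have "\<dots> = trace_on (span F) (\<lambda>x. h (f x))"
    using h f by (rule expand[symmetric])
  finally show ?thesis .
qed

text \<open>\<open>P\<close> and \<open>M\<close> stand for frames of E_+ and E_-. The assumptions
  are symmetric in them, so by \<open>swap\<close> every fact proved for E_+ also holds for E_-.
  Since distinct frame elements are orthogonal, disjointness makes the two spans orthogonal.\<close>

locale orthogonal_splitting =
  fixes P M :: "'a::real_vector gspace set"
  assumes frame: "orthogonal_frame (P \<union> M)"
    and disjoint: "P \<inter> M = {}"
    and spanning: "span (P \<union> M) = UNIV"
begin

lemma swap: "orthogonal_splitting M P"
  using frame disjoint spanning by unfold_locales (simp_all add: Un_commute Int_commute)

lemma frame_P: "orthogonal_frame P"
  using orthogonal_frame_subset[OF frame] by blast

lemma orthogonal: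
  assumes "x \<in> span P" "y \<in> span M"
  shows "gpair x y = 0"
proof -
  have "gpair p m = 0" if "p \<in> P" "m \<in> M" for p m
  proof -
    have "p \<noteq> m" using that disjoint by auto
    then show ?thesis using frame that by (simp add: orthogonal_frame_def)
  qed
  then have "gpair p y = 0" if "p \<in> P" for p
    using that by (intro real_vector.linear_eq_0_on_span[OF linear_gpair _ assms(2)]) blast
  then have "gpair y x = 0"
    by (intro real_vector.linear_eq_0_on_span[OF linear_gpair _ assms(1)]) (simp add: gpair_sym)
  then show ?thesis by (simp add: gpair_sym)
qed

lemma expansion: "(x :: 'a gspace) = (\<Sum>y\<in>P \<union> M. (gpair x y / gpair y y) *\<^sub>R y)"
  by (rule orthogonal_frame_expansion[OF frame]) (simp add: spanning)

lemma gpair_eqI: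
  assumes "\<And>w. gpair x w = gpair y w"
  shows "(x :: 'a gspace) = y"
proof -
  have "x = (\<Sum>z\<in>P \<union> M. (gpair x z / gpair z z) *\<^sub>R z)"
    by (rule expansion)
  also have "\<dots> = (\<Sum>z\<in>P \<union> M. (gpair y z / gpair z z) *\<^sub>R z)"
    by (simp only: assms)
  also have "\<dots> = y"
    by (rule expansion[symmetric])
  finally show ?thesis .
qed

lemma eq_0_on_P:
  assumes "x \<in> span P" "\<And>w. w \<in> span P \<Longrightarrow> gpair x w = 0"
  shows "x = 0"
proof -
  have "x = (\<Sum>y\<in>P. (gpair x y / gpair y y) *\<^sub>R y)"
    by (rule orthogonal_frame_expansion[OF frame_P assms(1)])
  also have "\<dots> = 0"
    by (rule sum.neutral) (simp add: assms(2) span_base)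
  finally show ?thesis .
qed

lemma in_span_P:
  assumes "\<And>y. y \<in> M \<Longrightarrow> gpair x y = 0"
  shows "x \<in> span P"
proof -
  have "x = (\<Sum>y\<in>P \<union> M. (gpair x y / gpair y y) *\<^sub>R y)"
    by (rule expansion)
  also have "\<dots> \<in> span P"
  proof (rule span_sum)
    fix y assume "y \<in> P \<union> M"
    then show "(gpair x y / gpair y y) *\<^sub>R y \<in> span P"
      using assms[of y] by (cases "y \<in> P") (auto intro: span_scale span_base simp: span_zero)
  qed
  finally show ?thesis .
qed

lemma gadjoint:
  assumes "linear A"
  shows "gpair (A x) (y :: 'a gspace) = gpair (x :: 'a gspace) (gadjoint A y)"
proof -
  \<comment> \<open>The frame formula for the adjoint shows that an adjoint exists, so the choice in
    \<open>gadjoint\<close> really yields one.\<close>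
  let ?A' = "\<lambda>y. \<Sum>e\<in>P \<union> M. (gpair (A e) y / gpair e e) *\<^sub>R e"
  have A': "gpair (A x) y = gpair x (?A' y)" for x y
  proof -
    have "A x = A (\<Sum>e\<in>P \<union> M. (gpair x e / gpair e e) *\<^sub>R e)"
      by (rule arg_cong[OF expansion])
    then have "gpair (A x) y = gpair (A (\<Sum>e\<in>P \<union> M. (gpair x e / gpair e e) *\<^sub>R e)) y"
      by (rule arg_cong)
    then show ?thesis
      by (simp add: linear_sum[OF assms] linear_scale[OF assms] gpair_left gpair_right mult.commute)
  qed
  have "\<exists>A'. \<forall>x y. gpair (A x) y = gpair x (A' y)"
    by (rule exI[where x = ?A']) (intro allI A')
  then have "\<forall>x y. gpair (A x) y = gpair x (gadjoint A y)"
    unfolding gadjoint_def by (rule someI_ex)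
  then show ?thesis by blast
qed

text \<open>Pairing the torsion with \<open>w\<close> turns its adjoint term into
  \<open>gpair (D w u) v\<close>, and the pairing is nondegenerate. Vanishing torsion thus becomes a
  trilinear identity.\<close>

lemma torsion_eq_0_iff:
  fixes D :: "'a gspace \<Rightarrow> 'a gspace \<Rightarrow> 'a gspace"
  assumes "bilinear D"
  shows "torsion br H D u v = 0 \<longleftrightarrow> (\<forall>w. gpair (dorfman br H u v) w
    = gpair (D u v) w - gpair (D v u) w + gpair (D w u) v)"
proof -
  have "gpair (torsion br H D u v) w = gpair (D u v) w - gpair (D v u) w
      - gpair (dorfman br H u v) w + gpair (D w u) v" for w
    using gadjoint[OF bilinear_linear_left[OF assms], of w u v]
    by (simp add: torsion_def gpair_left gpair_sym[of "gadjoint _ _" w])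
  then have "gpair (torsion br H D u v) w = 0 \<longleftrightarrow>
      gpair (dorfman br H u v) w = gpair (D u v) w - gpair (D v u) w + gpair (D w u) v" for w
    by auto
  moreover have "torsion br H D u v = 0 \<longleftrightarrow> (\<forall>w. gpair (torsion br H D u v) w = 0)"
    using gpair_eqI[of "torsion br H D u v" 0] by (metis gpair_left(1))
  ultimately show ?thesis by metis
qed

end

section \<open>Variation of the connection\<close>

text \<open>For complementary \<open>V\<close> and \<open>W\<close>, this is the shape shared by
  differences of Levi-Civita connections and elements of the first prolongation.\<close>

definition block_diagonal ::
    "'e::real_vector set \<Rightarrow> 'e set \<Rightarrow> ('e \<Rightarrow> 'e \<Rightarrow> 'e) \<Rightarrow> bool" where
  "block_diagonal V W T \<longleftrightarrow> bilinear T \<and> (\<forall>u\<in>V. \<forall>v\<in>V. T u v \<in> V) \<and> (\<forall>u\<in>W. \<forall>v\<in>W. T u v \<in> W) \<and>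
    (\<forall>u\<in>V. \<forall>v\<in>W. T u v = 0 \<and> T v u = 0)"

lemma block_diagonalD:
  assumes "block_diagonal V W T"
  shows "bilinear T" and "u \<in> V \<Longrightarrow> v \<in> V \<Longrightarrow> T u v \<in> V"
    and "u \<in> W \<Longrightarrow> v \<in> W \<Longrightarrow> T u v \<in> W"
    and "u \<in> V \<Longrightarrow> v \<in> W \<Longrightarrow> T u v = 0" and "u \<in> W \<Longrightarrow> v \<in> V \<Longrightarrow> T u v = 0"
  using assms unfolding block_diagonal_def by blast+

lemma block_diagonal_swap: "block_diagonal V W T \<longleftrightarrow> block_diagonal W V T"
  unfolding block_diagonal_def by blast

text \<open>\<open>levi_civita\<close> with E_+ and E_- turned into parameters, so that their roles
  can be exchanged.\<close>

definition split_levi_civita :: "('a::real_vector \<Rightarrow> 'a \<Rightarrow> 'a) \<Rightarrow> ('a \<Rightarrow> 'a \<Rightarrow> 'a \<Rightarrow> real) \<Rightarrow>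
    'a gspace set \<Rightarrow> 'a gspace set \<Rightarrow> ('a gspace \<Rightarrow> 'a gspace \<Rightarrow> 'a gspace) \<Rightarrow> bool" where
  "split_levi_civita br H V W D \<longleftrightarrow> gen_connection D \<and> (\<forall>u v. torsion br H D u v = 0) \<and>
    (\<forall>u. D u ` V \<subseteq> V) \<and> (\<forall>u. D u ` W \<subseteq> W)"

lemma split_levi_civitaD:
  assumes "split_levi_civita br H V W D"
  shows "bilinear D" and "gpair (D u v) w + gpair v (D u w) = 0"
    and "torsion br H D u v = 0" and "v \<in> V \<Longrightarrow> D u v \<in> V" and "v \<in> W \<Longrightarrow> D u v \<in> W"
  using assms unfolding split_levi_civita_def gen_connection_def by (meson image_subset_iff)+

lemma split_levi_civita_swap: "split_levi_civita br H V W D \<longleftrightarrow> split_levi_civita br H W V D"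
  by (simp only: split_levi_civita_def conj_ac)

section \<open>Curvature and its traces under a change of Levi-Civita connection\<close>

context orthogonal_splitting
begin

lemma gpair_dorfman_torsion_free:
  assumes "split_levi_civita br H (span P) (span M) D"
  shows "gpair (dorfman br H u v) w = gpair (D u v) w - gpair (D v u) w + gpair (D w u) v"
  by (rule spec[OF iffD1[OF torsion_eq_0_iff[OF split_levi_civitaD(1)[OF assms]]
          split_levi_civitaD(3)[OF assms]]])

text \<open>The third torsion term \<open>gpair (D x w) u\<close> vanishes: \<open>D x\<close>
  preserves E_+, which is orthogonal to E_-.\<close>

lemma mixed_dorfman:
  assumes D: "split_levi_civita br H (span P) (span M) D" and "w \<in> span P" "u \<in> span M"
  shows "dorfman br H w u = D w u - D u w"
proof (rule gpair_eqI)
  fix x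
  have "gpair (D x w) u = 0"
    by (intro orthogonal split_levi_civitaD(4)[OF D] assms)
  then show "gpair (dorfman br H w u) x = gpair (D w u - D u w) x"
    by (simp add: gpair_dorfman_torsion_free[OF D] gpair_left)
qed

lemma block_diagonal_difference_mixed:
  assumes pres: "\<And>u v. v \<in> span P \<Longrightarrow> T u v \<in> span P" "\<And>u v. v \<in> span M \<Longrightarrow> T u v \<in> span M"
    and tor: "\<And>u v w. gpair (T u v) w - gpair (T v u) w + gpair (T w u) v = 0"
    and uv: "u \<in> span M" "v \<in> span P"
  shows "T u v = 0"
proof (rule eq_0_on_P)
  show "T u v \<in> span P" using pres uv by blast
  fix w assume w: "w \<in> span P"
  have "gpair (T v u) w = 0" "gpair (T w u) v = 0"
    using orthogonal[OF w, of "T v u"] orthogonal[OF uv(2), of "T w u"] pres uv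
    by (simp_all add: gpair_sym)
  with tor[where u=u and v=v and w=w] show "gpair (T u v) w = 0" by simp
qed

lemma block_diagonal_difference:
  assumes D: "split_levi_civita br H (span P) (span M) D"
    and D': "split_levi_civita br H (span P) (span M) D'"
  shows "block_diagonal (span P) (span M) (\<lambda>u v. D' u v - D u v)" (is "block_diagonal _ _ ?T")
proof -
  interpret sw: orthogonal_splitting M P by (rule swap)
  have bilD: "bilinear D" "bilinear D'"
    by (rule split_levi_civitaD[OF D] split_levi_civitaD[OF D'])+
  then have bil: "bilinear ?T"
    by (simp add: bilinear_def linear_compose_sub)
  have pres: "?T u v \<in> span P" if "v \<in> span P" for u v
    using that by (intro span_diff split_levi_civitaD(4)[OF D] split_levi_civitaD(4)[OF D'])
  have pres': "?T u v \<in> span M" if "v \<in> span M" for u v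
    using that by (intro span_diff split_levi_civitaD(5)[OF D] split_levi_civitaD(5)[OF D'])
  \<comment> \<open>Subtracting the torsion identities of the two connections removes the
    bracket.\<close>
  have tor: "gpair (?T u v) w - gpair (?T v u) w + gpair (?T w u) v = 0" for u v w
    using gpair_dorfman_torsion_free[OF D, of u v w] gpair_dorfman_torsion_free[OF D', of u v w]
    by (simp add: gpair_left)
  have mixed: "?T u v = 0" if "u \<in> span M" "v \<in> span P" for u v
    using that by (intro block_diagonal_difference_mixed[where T = ?T] pres pres' tor)
  have mixed': "?T u v = 0" if "u \<in> span P" "v \<in> span M" for u v
    using that by (intro sw.block_diagonal_difference_mixed[where T = ?T] pres pres' tor)
  show ?thesis
    unfolding block_diagonal_def by (intro conjI ballI bil pres pres' mixed mixed')
qed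

lemma curvature_variation:
  assumes D: "split_levi_civita br H (span P) (span M) D"
    and T: "block_diagonal (span P) (span M) T"
    and w: "w \<in> span P" and u: "u \<in> span M" and v: "v \<in> span P"
  shows "curvature br H (\<lambda>u v. D u v + T u v) w u v
    = curvature br H D w u v + d_conn br H D T w u v"
proof -
  have bil: "bilinear D" "bilinear T"
    by (rule split_levi_civitaD[OF D] block_diagonalD[OF T])+
  \<comment> \<open>These facts remove both quadratic terms: \<open>T w (T u v)\<close> because
    \<open>T u v = 0\<close>, and \<open>T u (T w v)\<close> because \<open>T w v\<close> stays in
    E_+, where \<open>T u\<close> is zero.\<close>
  have "T u v = 0" "T w v \<in> span P"
    using w u v by (simp_all add: block_diagonalD[OF T])
  moreover from this have "T u (T w v) = 0"
    using u by (simp add: block_diagonalD[OF T])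
  ultimately show ?thesis
    by (simp add: curvature_def d_conn_def bilinear_radd[OF bil(1)] bilinear_radd[OF bil(2)]
        bilinear_rzero[OF bil(1)] bilinear_rzero[OF bil(2)])
qed

text \<open>By \<open>mixed_dorfman\<close> the bracket contributes \<open>T (D w u) v\<close>,
  which is zero as \<open>D w u\<close> lies in E_-, and \<open>T (D u w) v\<close>, which survives.
  The grouping exhibits the commutator of \<open>\<lambda>w. T w v\<close> with
  \<open>D u\<close>.\<close>

lemma d_conn_mixed:
  assumes D: "split_levi_civita br H (span P) (span M) D"
    and T: "block_diagonal (span P) (span M) T"
    and w: "w \<in> span P" and u: "u \<in> span M" and v: "v \<in> span P"
  shows "d_conn br H D T w u v = T w (D u v) + (T (D u w) v - D u (T w v))"
proof -
  have bil: "bilinear D" "bilinear T"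
    by (rule split_levi_civitaD[OF D] block_diagonalD[OF T])+
  have "D w v \<in> span P" "D w u \<in> span M"
    using w u v by (simp_all add: split_levi_civitaD[OF D])
  then have "T u (D w v) = 0" "T (D w u) v = 0" "T u v = 0"
    using w u v by (simp_all add: block_diagonalD[OF T])
  then show ?thesis
    by (simp add: d_conn_def mixed_dorfman[OF D w u] bilinear_lsub[OF bil(2)]
        bilinear_rzero[OF bil(1)])
qed

text \<open>Frame vectors \<open>y\<close> in \<open>M\<close> contribute nothing to the full trace,
  since \<open>T y v = 0\<close> there.\<close>

lemma divergence_block_diagonal:
  assumes T: "block_diagonal (span P) (span M) T" and v: "v \<in> span P"
  shows "trace_on (span P) (\<lambda>w. T w v) = divergence T v"
proof -
  have lin: "linear (\<lambda>w. T w v)"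
    by (rule bilinear_linear_left[OF block_diagonalD(1)[OF T]])
  have "divergence T v = (\<Sum>y\<in>P \<union> M. gpair (T y v) y / gpair y y)"
    unfolding divergence_def using trace_on_orthogonal_frame[OF frame lin] spanning by simp
  also have "\<dots> = (\<Sum>y\<in>P. gpair (T y v) y / gpair y y)"
  proof (rule sum.mono_neutral_right)
    show "\<forall>y\<in>P \<union> M - P. gpair (T y v) y / gpair y y = 0"
      using block_diagonalD(5)[OF T span_base[of _ M] v] by (auto simp: gpair_left)
  qed (use frame in \<open>auto simp: orthogonal_frame_def\<close>)
  also have "\<dots> = trace_on (span P) (\<lambda>w. T w v)"
    by (intro trace_on_orthogonal_frame[symmetric] frame_P lin block_diagonalD(2)[OF T] v)
  finally show ?thesis by simp
qed

lemma trace_d_conn: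
  assumes D: "split_levi_civita br H (span P) (span M) D"
    and T: "block_diagonal (span P) (span M) T"
    and u: "u \<in> span M" and v: "v \<in> span P"
  shows "trace_on (span P) (\<lambda>w. d_conn br H D T w u v) = divergence T (D u v)"
proof -
  have linT: "linear (\<lambda>w. T w v)" and linD: "linear (D u)"
    by (rule bilinear_linear_left[OF block_diagonalD(1)[OF T]]
        bilinear_linear_right[OF split_levi_civitaD(1)[OF D]])+
  have presT: "T w x \<in> span P" if "w \<in> span P" "x \<in> span P" for w x
    using that by (rule block_diagonalD[OF T])
  have presD: "D u w \<in> span P" if "w \<in> span P" for w
    using that by (rule split_levi_civitaD(4)[OF D])
  note ind = orthogonal_frame_independent[OF frame_P]
  have comm: "trace_on (span P) (\<lambda>w. T (D u w) v - D u (T w v)) = 0"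
  proof -
    \<comment> \<open>Writing the first term as the commutator plus \<open>D u (T w v)\<close> lets
      additivity express the trace of the commutator as a difference of two traces, which agree by
      \<open>trace_on_commute\<close>.\<close>
    have "trace_on (span P) (\<lambda>w. T (D u w) v)
        = trace_on (span P) (\<lambda>w. (T (D u w) v - D u (T w v)) + D u (T w v))"
      by simp
    also have "\<dots> = trace_on (span P) (\<lambda>w. T (D u w) v - D u (T w v))
        + trace_on (span P) (\<lambda>w. D u (T w v))"
      by (intro trace_on_add[OF ind refl] span_diff presT presD v)
    finally show ?thesis
      using trace_on_commute[OF frame_P linT presT[OF _ v] linD presD] by simp
  qed
  have "trace_on (span P) (\<lambda>w. d_conn br H D T w u v)
      = trace_on (span P) (\<lambda>w. T w (D u v) + (T (D u w) v - D u (T w v)))"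
    using d_conn_mixed[OF D T _ u v] by (intro trace_on_cong[OF ind refl])
  also have "\<dots> = trace_on (span P) (\<lambda>w. T w (D u v))"
    by (subst trace_on_add[OF ind refl]) (simp_all add: comm span_diff presT presD v)
  finally show ?thesis
    using divergence_block_diagonal[OF T presD[OF v]] by simp
qed

text \<open>\<open>D'\<close> enters the right side only through its divergence. This is the
  independence of the Ricci curvature from the connection, and it makes the choice in
  \<open>lc_with_div\<close> harmless.\<close>

lemma ricci_variation:
  assumes D: "split_levi_civita br H (span P) (span M) D"
    and D': "split_levi_civita br H (span P) (span M) D'"
    and u: "u \<in> span M" and v: "v \<in> span P"
  shows "trace_on (span P) (\<lambda>w. curvature br H D' w u v)
    = trace_on (span P) (\<lambda>w. curvature br H D w u v) + divergence D' (D u v) - divergence D (D u v)"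
proof -
  let ?T = "\<lambda>u v. D' u v - D u v"
  note ind = orthogonal_frame_independent[OF frame_P]
  have T: "block_diagonal (span P) (span M) ?T"
    by (rule block_diagonal_difference[OF D D'])
  have D_P: "D x y \<in> span P" if "y \<in> span P" for x y
    using that by (rule split_levi_civitaD(4)[OF D])
  have T_P: "?T x y \<in> span P" if "x \<in> span P" "y \<in> span P" for x y
    using that by (rule block_diagonalD[OF T])
  have "trace_on (span P) (\<lambda>w. curvature br H D' w u v)
      = trace_on (span P) (\<lambda>w. curvature br H D w u v + d_conn br H D ?T w u v)"
    using curvature_variation[OF D T _ u v] by (intro trace_on_cong[OF ind refl]) simp
  also have "\<dots> = trace_on (span P) (\<lambda>w. curvature br H D w u v)
      + trace_on (span P) (\<lambda>w. d_conn br H D ?T w u v)"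
  proof (rule trace_on_add[OF ind refl])
    fix w assume w: "w \<in> span P"
    show "curvature br H D w u v \<in> span P"
      unfolding curvature_def by (intro span_diff D_P v)
    show "d_conn br H D ?T w u v \<in> span P"
      unfolding d_conn_mixed[OF D T w u v] by (intro span_add span_diff[of "?T _ _"] T_P D_P v w)
  qed
  also have "trace_on (span P) (\<lambda>w. d_conn br H D ?T w u v) = divergence ?T (D u v)"
    by (rule trace_d_conn[OF D T u v])
  also have "\<dots> = divergence D' (D u v) - divergence D (D u v)"
    using trace_on_add[OF orthogonal_frame_independent[OF frame] spanning,
        of "\<lambda>w. ?T w (D u v)" "\<lambda>w. D w (D u v)"]
    by (simp add: divergence_def)
  finally show ?thesis by simp
qed

end

section \<open>The canonical connection\<close>

lemma pair_cov_flat: "bilinear g \<Longrightarrow> pair_cov (flat g x) y = g x y"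
  by (simp add: flat_def pair_cov_Covector bilinear_linear_right)

lemma linear_flat: "bilinear g \<Longrightarrow> linear (flat g)"
  by (rule linearI; rule covector_eqI) (simp_all add: pair_cov_flat bilinear_ladd bilinear_lmul)

lemma gpair_dorfman:
  assumes "bilinear br" "three_form H"
  shows "2 * gpair (dorfman br H u v) w = H (fst u) (fst v) (fst w)
    + pair_cov (snd u) (br (fst v) (fst w)) - pair_cov (snd v) (br (fst u) (fst w))
    + pair_cov (snd w) (br (fst u) (fst v))"
proof -
  have "linear (\<lambda>z. pair_cov \<eta> (br x z))" for \<eta> x
    using linear_compose[OF bilinear_linear_right[OF assms(1), of x] linear_pair_cov[of \<eta>]]
    by (simp add: o_def)
  moreover have "linear (\<lambda>z. H x y z)" for x y
    using assms(2) by (simp add: three_form_def)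
  ultimately show ?thesis
    by (simp add: gpair_def dorfman_def coad_def pair_cov_Covector)
qed

lemma alternating_swap:
  fixes f :: "'a::real_vector \<Rightarrow> 'a \<Rightarrow> 'b::real_vector"
  assumes "\<And>y. linear (\<lambda>x. f x y)" "\<And>x. linear (f x)" "\<And>x. f x x = 0"
  shows "f y x = - f x y"
proof -
  have "f (x + y) (x + y) = f x x + f x y + (f y x + f y y)"
    by (simp only: linear_add[OF assms(1)] linear_add[OF assms(2)] ac_simps)
  then have "f x y + f y x = 0" by (simp add: assms(3))
  then show ?thesis
    by (simp add: eq_neg_iff_add_eq_0 add.commute)
qed

text \<open>The \<open>H\<close> term is alternating, and skewness of \<open>br\<close> permutes the
  three bracket terms up to sign. The two transpositions generate all permutations, so the trilinear
  form is totally skew.\<close>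

lemma gpair_dorfman_alternating:
  assumes "lie_algebra br" "three_form H"
  shows "gpair (dorfman br H v u) w = - gpair (dorfman br H u v) w"
    and "gpair (dorfman br H u w) v = - gpair (dorfman br H u v) w"
proof -
  have br: "bilinear br" "\<And>x. br x x = 0" using assms(1) by (auto simp: lie_algebra_def)
  have br_swap: "br y x = - br x y" for x y
    using br by (intro alternating_swap) (auto simp: bilinear_def)
  have H: "\<And>y z. linear (\<lambda>x. H x y z)" "\<And>x z. linear (\<lambda>y. H x y z)" "\<And>x y. linear (H x y)"
    "\<And>x z. H x x z = 0" "\<And>x y. H x y y = 0"
    using assms(2) by (auto simp: three_form_def)
  have H12: "H y x z = - H x y z" for x y z
    using alternating_swap[where f = "\<lambda>x y. H x y z"] H by blast
  have H23: "H x z y = - H x y z" for x y z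
    using alternating_swap[where f = "H x"] H by blast
  have "2 * gpair (dorfman br H v u) w = - (2 * gpair (dorfman br H u v) w)"
    unfolding gpair_dorfman[OF br(1) assms(2)]
    using H12[of "fst u" "fst v" "fst w"] br_swap[of "fst u" "fst v"]
    by (simp add: linear_neg[OF linear_pair_cov])
  then show "gpair (dorfman br H v u) w = - gpair (dorfman br H u v) w" by simp
  have "2 * gpair (dorfman br H u w) v = - (2 * gpair (dorfman br H u v) w)"
    unfolding gpair_dorfman[OF br(1) assms(2)]
    using H23[of "fst u" "fst v" "fst w"] br_swap[of "fst v" "fst w"]
    by (simp add: linear_neg[OF linear_pair_cov])
  then show "gpair (dorfman br H u w) v = - gpair (dorfman br H u v) w" by simp
qed

text \<open>Total skewness gives cyclic invariance, which moves any argument into the last slot,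
  where linearity is that of the pairing.\<close>

lemma linear_gpair_dorfman:
  assumes "lie_algebra br" "three_form H"
  shows "linear (\<lambda>u. gpair (dorfman br H u v) w)" "linear (\<lambda>v. gpair (dorfman br H u v) w)"
proof -
  note alt = gpair_dorfman_alternating[OF assms]
  have cyc: "gpair (dorfman br H u v) w = gpair (dorfman br H v w) u" for u v w
    using alt(1)[of w v u] alt(2)[of v u w] alt(1)[of u v w] by simp
  show "linear (\<lambda>u. gpair (dorfman br H u v) w)"
    unfolding cyc[of _ v w] by (rule linear_gpair)
  show "linear (\<lambda>v. gpair (dorfman br H u v) w)"
    unfolding cyc[of u _ w] cyc[of _ w u] by (rule linear_gpair)
qed

lemma orthonormal_basis_splitting:
  assumes fin: "finite_dimensional TYPE('a::real_vector)"
    and g: "pseudo_metric (g :: 'a \<Rightarrow> 'a \<Rightarrow> real)" and B: "orthonormal_basis g B"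
  defines "P \<equiv> (\<lambda>v. (v, flat g v)) ` B" and "M \<equiv> (\<lambda>v. (v, - flat g v)) ` B"
  shows "orthogonal_splitting P M" "E_plus g = span P" "E_minus g = span M"
proof -
  have bil: "bilinear g" and sym: "g x y = g y x" for x y
    using g by (auto simp: pseudo_metric_def)
  have B_ind: "independent B" and B_span: "span B = UNIV"
    and B_norm: "\<And>x. x \<in> B \<Longrightarrow> g x x \<noteq> 0 \<and> g x x * g x x = 1"
    and B_orth: "\<And>x y. x \<in> B \<Longrightarrow> y \<in> B \<Longrightarrow> x \<noteq> y \<Longrightarrow> g x y = 0"
    using B by (auto simp: orthonormal_basis_def)
  have finB: "finite B"
    using fin independent_span_bound[of _ B] B_ind unfolding finite_dimensional_def by auto
  have lin: "linear (\<lambda>v. (v, flat g v))" "linear (\<lambda>v. (v, - flat g v))"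
    using linear_flat[OF bil]
    by (auto intro!: linearI simp: linear_add linear_scale)
  show Ep: "E_plus g = span P"
    unfolding P_def linear_span_image[OF lin(1)] B_span by (auto simp: E_plus_def)
  show Em: "E_minus g = span M"
    unfolding M_def linear_span_image[OF lin(2)] B_span by (auto simp: E_minus_def)
  \<comment> \<open>The pairing restricts to \<open>g\<close> on E_+ and to \<open>- g\<close> on
    E_-, and the two subspaces are orthogonal.\<close>
  have pp: "gpair (v, flat g v) (w, flat g w) = g v w"
    and mm: "gpair (v, - flat g v) (w, - flat g w) = - g v w"
    and pm: "gpair (v, flat g v) (w, - flat g w) = 0"
    and mp: "gpair (v, - flat g v) (w, flat g w) = 0" for v w
    by (simp_all add: gpair_def pair_cov_flat[OF bil] sym[of w v])
  have flat_surj: "\<exists>Y. flat g Y = \<xi>" for \<xi>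
  proof -
    \<comment> \<open>The inverse of \<open>flat g\<close> in the basis: \<open>g b b\<close> is 1
      or -1, hence its own reciprocal, and serves as a factor in place of a divisor.\<close>
    let ?Y = "\<Sum>b\<in>B. (pair_cov \<xi> b * g b b) *\<^sub>R b"
    have lin_diff: "linear (\<lambda>x. pair_cov (flat g ?Y) x - pair_cov \<xi> x)"
      by (intro linear_compose_sub linear_pair_cov)
    have "pair_cov (flat g ?Y) b - pair_cov \<xi> b = 0" if "b \<in> B" for b
    proof -
      have "g ?Y b = (\<Sum>c\<in>B. pair_cov \<xi> c * g c c * g c b)"
        by (simp add: linear_sum[OF bilinear_linear_left[OF bil]] bilinear_lmul[OF bil])
      also have "\<dots> = (\<Sum>c\<in>B. if c = b then pair_cov \<xi> b else 0)"
        using B_norm B_orth that by (intro sum.cong) auto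
      finally show ?thesis
        using finB that by (simp add: pair_cov_flat[OF bil])
    qed
    then have "pair_cov (flat g ?Y) x - pair_cov \<xi> x = 0" for x
      using real_vector.linear_eq_0_on_span[OF lin_diff] B_span by blast
    then have "flat g ?Y = \<xi>"
      by (intro covector_eqI) simp
    then show ?thesis by blast
  qed
  have "x \<in> span (P \<union> M)" for x :: "'a gspace"
  proof -
    obtain Y where Y: "flat g Y = snd x" using flat_surj by blast
    \<comment> \<open>For x = X + gY the components are (X+Y)/2 in E_+ and (X-Y)/2 in E_-: their
      vector parts add up to X, and g of their difference is gY.\<close>
    let ?a = "(1/2) *\<^sub>R (fst x + Y)" and ?b = "(1/2) *\<^sub>R (fst x - Y)"
    have "flat g ?a - flat g ?b = flat g (?a - ?b)"
      using linear_diff[OF linear_flat[OF bil]] by simp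
    also have "?a - ?b = Y"
      by (simp flip: scaleR_diff_right add: scaleR_2[symmetric])
    finally have snd: "flat g ?a - flat g ?b = snd x" using Y by simp
    have "?a + ?b = fst x"
      by (simp flip: scaleR_add_right add: scaleR_2[symmetric])
    with snd have x: "x = (?a, flat g ?a) + (?b, - flat g ?b)"
      by (simp add: prod_eq_iff)
    have "(?a, flat g ?a) \<in> span P" "(?b, - flat g ?b) \<in> span M"
      unfolding Ep[symmetric] Em[symmetric] E_plus_def E_minus_def by blast+
    then have "(?a, flat g ?a) + (?b, - flat g ?b) \<in> span (P \<union> M)"
      using span_mono[of P "P \<union> M"] span_mono[of M "P \<union> M"] by (intro span_add) blast+
    then show ?thesis by (subst x)
  qed
  moreover have "orthogonal_frame (P \<union> M)"
    unfolding orthogonal_frame_def P_def M_def ball_Un ball_simps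
    using finB B_norm B_orth by (simp add: pp mm pm mp)
  moreover have "P \<inter> M = {}"
  proof -
    \<comment> \<open>A common vector would pair with itself to \<open>g v v\<close> by
      \<open>pp\<close> and to 0 by \<open>pm\<close>.\<close>
    have False if "v \<in> B" "w \<in> B" "(v, flat g v) = (w, - flat g w)" for v w
      using pp[of v v] pm[of v w] that B_norm[of v] by simp
    then show ?thesis unfolding P_def M_def by blast
  qed
  ultimately show "orthogonal_splitting P M"
    by (intro orthogonal_splitting.intro UNIV_eq_I[symmetric])
qed

section \<open>The canonical connection and its shifts by the first prolongation\<close>

context orthogonal_splitting
begin

lemma trilinear_eq_0:
  assumes "\<And>y z. linear (\<lambda>x. f x y z)" and "\<And>x z. linear (\<lambda>y. f x y z)"
    and "\<And>x y. linear (f x y)"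
    and "\<And>a b c. a \<in> P \<union> M \<Longrightarrow> b \<in> P \<union> M \<Longrightarrow> c \<in> P \<union> M \<Longrightarrow> f a b c = 0"
  shows "f x y z = 0"
  by (rule trilinear_eq_0_on_span[where f = f and A = "P \<union> M" and B = "P \<union> M" and C = "P \<union> M"])
    (rule assms | assumption | simp add: spanning)+

lemma linear_connection_pairing:
  assumes "bilinear D"
  shows "linear (\<lambda>x. gpair (D x y) z)" "linear (\<lambda>y. gpair (D x y) z)"
  using assms by (auto intro!: linear_gpair_comp simp: bilinear_def)

text \<open>All is checked on the frame, where the coefficients of \<open>D\<close> are a third of,
  equal to, or zero times the totally skew form of the bracket. In the torsion identity, arguments
  from one half give three equal thirds, and mixed arguments leave a single full term.\<close>

lemma canonical_levi_civita:
  assumes L: "lie_algebra br" "three_form H" and bil: "bilinear D"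
    and coeff: "\<And>a b c. a \<in> P \<union> M \<Longrightarrow> b \<in> P \<union> M \<Longrightarrow> c \<in> P \<union> M \<Longrightarrow>
      gpair (D a b) c = canonical_coeff br H P M a b c"
  shows "split_levi_civita br H (span P) (span M) D" and "divergence D v = 0"
proof -
  let ?B = "\<lambda>u v w. gpair (dorfman br H u v) w"
  interpret sw: orthogonal_splitting M P by (rule swap)
  note alt = gpair_dorfman_alternating[OF L]
  note linD = linear_connection_pairing[OF bil]
  have excl: "x \<notin> M" if "x \<in> P" for x using that disjoint by blast
  have excl': "x \<notin> P" if "x \<in> M" for x using that disjoint by blast
  have D_coeff:
    "a \<in> P \<Longrightarrow> b \<in> P \<Longrightarrow> c \<in> P \<Longrightarrow> gpair (D a b) c = ?B a b c / 3"
    "a \<in> M \<Longrightarrow> b \<in> P \<Longrightarrow> c \<in> P \<Longrightarrow> gpair (D a b) c = ?B a b c"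
    "a \<in> P \<Longrightarrow> b \<in> M \<Longrightarrow> c \<in> M \<Longrightarrow> gpair (D a b) c = ?B a b c"
    "a \<in> M \<Longrightarrow> b \<in> M \<Longrightarrow> c \<in> M \<Longrightarrow> gpair (D a b) c = ?B a b c / 3"
    "a \<in> P \<union> M \<Longrightarrow> b \<in> P \<Longrightarrow> c \<in> M \<Longrightarrow> gpair (D a b) c = 0"
    "a \<in> P \<union> M \<Longrightarrow> b \<in> M \<Longrightarrow> c \<in> P \<Longrightarrow> gpair (D a b) c = 0" for a b c
    by (simp_all add: coeff canonical_coeff_def excl excl')
  have skew: "gpair (D u v) w + gpair (D u w) v = 0" for u v w
  proof (rule trilinear_eq_0[where f = "\<lambda>u v w. gpair (D u v) w + gpair (D u w) v"])
    fix a b c assume "a \<in> P \<union> M" "b \<in> P \<union> M" "c \<in> P \<union> M"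
    then show "gpair (D a b) c + gpair (D a c) b = 0"
      by (elim UnE) (simp_all add: D_coeff alt(2)[of a b c])
  qed (intro linear_compose_add linD linear_gpair)+
  have tor: "?B u v w - (gpair (D u v) w - gpair (D v u) w + gpair (D w u) v) = 0" for u v w
  proof (rule trilinear_eq_0[where
        f = "\<lambda>u v w. ?B u v w - (gpair (D u v) w - gpair (D v u) w + gpair (D w u) v)"])
    fix a b c assume "a \<in> P \<union> M" "b \<in> P \<union> M" "c \<in> P \<union> M"
    then show "?B a b c - (gpair (D a b) c - gpair (D b a) c + gpair (D c a) b) = 0"
      by (elim UnE) (simp_all add: D_coeff alt(1)[of b a c] alt(2)[of a c b] alt(1)[of c a b])
  qed (intro linear_compose_add linear_compose_sub linD linear_gpair linear_gpair_dorfman[OF L])+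
  have pres_P: "D u v \<in> span P" if "v \<in> span P" for u v
  proof (rule in_span_P)
    fix c assume "c \<in> M"
    show "gpair (D u v) c = 0"
    proof (rule trilinear_eq_0_on_span[where f = "\<lambda>u v w. gpair (D u v) w" and A = "P \<union> M"
            and B = P and C = M])
      fix a b c assume "a \<in> P \<union> M" "b \<in> P" "c \<in> M"
      then show "gpair (D a b) c = 0"
        by (rule D_coeff)
    qed (use that \<open>c \<in> M\<close> spanning in \<open>auto intro: linD linear_gpair span_base\<close>)
  qed
  have pres_M: "D u v \<in> span M" if "v \<in> span M" for u v
  proof (rule sw.in_span_P)
    fix c assume "c \<in> P"
    show "gpair (D u v) c = 0"
    proof (rule trilinear_eq_0_on_span[where f = "\<lambda>u v w. gpair (D u v) w" and A = "P \<union> M"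
            and B = M and C = P])
      fix a b c assume "a \<in> P \<union> M" "b \<in> M" "c \<in> P"
      then show "gpair (D a b) c = 0"
        by (rule D_coeff)
    qed (use that \<open>c \<in> P\<close> spanning in \<open>auto intro: linD linear_gpair span_base\<close>)
  qed
  show "split_levi_civita br H (span P) (span M) D"
    unfolding split_levi_civita_def gen_connection_def torsion_eq_0_iff[OF bil]
  proof (intro conjI allI image_subsetI bil pres_P pres_M)
    fix u v w
    show "gpair (D u v) w + gpair v (D u w) = 0"
      using skew[of u v w] by (simp add: gpair_sym[of v])
    show "gpair (dorfman br H u v) w = gpair (D u v) w - gpair (D v u) w + gpair (D w u) v"
      using tor[of u v w] by simp
  qed
  \<comment> \<open>Every diagonal term of the trace is zero: for \<open>a\<close>, \<open>b\<close>
    in the same half by skewness of the bracket form, for different halves because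
    \<open>D a\<close> preserves each half.\<close>
  have "gpair (D a v) a = 0" if "a \<in> P \<union> M" for a
  proof (rule real_vector.linear_eq_0_on_span[where f = "\<lambda>v. gpair (D a v) a" and b = "P \<union> M"])
    fix b assume "b \<in> P \<union> M"
    then show "gpair (D a b) a = 0"
      using that alt(1)[of a b a] alt(2)[of a a b] alt(1)[of a a b]
      by (elim UnE) (simp_all add: D_coeff)
  qed (use linD spanning in auto)
  then show "divergence D v = 0"
    unfolding divergence_def
    using trace_on_orthogonal_frame[OF frame bilinear_linear_left[OF bil, of v]] spanning by simp
qed

text \<open>Skewness turns the torsion term \<open>- gpair (\<alpha> v u) w\<close> into
  \<open>gpair (\<alpha> v w) u\<close>, so the torsion changes by the cyclic sum, which vanishes.
  The E_- block follows from the exchanged splitting.\<close>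

lemma levi_civita_add_prolongation:
  assumes D: "split_levi_civita br H (span P) (span M) D"
    and \<alpha>: "\<alpha> \<in> prolongation_on (span P) (span M)"
  shows "split_levi_civita br H (span P) (span M) (\<lambda>u v. D u v + \<alpha> u v)"
proof -
  have bil: "bilinear \<alpha>" "bilinear D"
    and pres: "\<And>u v. u \<in> span P \<Longrightarrow> v \<in> span P \<Longrightarrow> \<alpha> u v \<in> span P"
    and zero: "\<And>u v. u \<in> span M \<Longrightarrow> \<alpha> u v = 0" "\<And>u v. v \<in> span M \<Longrightarrow> \<alpha> u v = 0"
    and skew_P: "\<And>u v w. u \<in> span P \<Longrightarrow> v \<in> span P \<Longrightarrow> w \<in> span P \<Longrightarrow>
      gpair (\<alpha> u v) w + gpair v (\<alpha> u w) = 0"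
    and cyc_P: "\<And>u v w. u \<in> span P \<Longrightarrow> v \<in> span P \<Longrightarrow> w \<in> span P \<Longrightarrow>
      gpair (\<alpha> u v) w + gpair (\<alpha> v w) u + gpair (\<alpha> w u) v = 0"
    using \<alpha> split_levi_civitaD(1)[OF D] unfolding prolongation_on_def mem_Collect_eq by meson+
  note lin = linear_connection_pairing[OF bil(1)]
  note zero_frame = zero(1)[OF span_base] zero(2)[OF span_base]
  \<comment> \<open>Being extended by zero, \<open>\<alpha>\<close> takes all its values in E_+,
    whatever its arguments.\<close>
  have orth: "gpair (\<alpha> u v) c = 0" if "c \<in> M" for u v c
  proof (rule trilinear_eq_0_on_span[where f = "\<lambda>u v w. gpair (\<alpha> u v) w" and A = "P \<union> M"
          and B = "P \<union> M" and C = M])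
    fix a b c assume "a \<in> P \<union> M" "b \<in> P \<union> M" "c \<in> M"
    then show "gpair (\<alpha> a b) c = 0"
      using orthogonal[OF pres[OF span_base span_base] span_base, of a b c]
      by (auto simp: zero_frame gpair_left)
  qed (use that spanning in \<open>auto intro: lin linear_gpair span_base\<close>)
  have skew: "gpair (\<alpha> u v) w + gpair (\<alpha> u w) v = 0" for u v w
  proof (rule trilinear_eq_0[where f = "\<lambda>u v w. gpair (\<alpha> u v) w + gpair (\<alpha> u w) v"])
    fix a b c assume abc: "a \<in> P \<union> M" "b \<in> P \<union> M" "c \<in> P \<union> M"
    \<comment> \<open>The prolongation conditions speak of arguments in E_+. If one comes from
      \<open>M\<close>, each term is zero by the extension or by \<open>orth\<close>.\<close>
    show "gpair (\<alpha> a b) c + gpair (\<alpha> a c) b = 0"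
    proof (cases "a \<in> M \<or> b \<in> M \<or> c \<in> M")
      case True
      then show ?thesis by (auto simp: zero_frame orth gpair_left)
    next
      case False
      then show ?thesis
        using skew_P[of a b c] abc by (simp add: span_base gpair_sym[of b "\<alpha> a c"])
    qed
  qed (intro linear_compose_add lin linear_gpair)+
  have cyc: "gpair (\<alpha> u v) w + gpair (\<alpha> v w) u + gpair (\<alpha> w u) v = 0" for u v w
  proof (rule trilinear_eq_0[where
        f = "\<lambda>u v w. gpair (\<alpha> u v) w + gpair (\<alpha> v w) u + gpair (\<alpha> w u) v"])
    fix a b c assume abc: "a \<in> P \<union> M" "b \<in> P \<union> M" "c \<in> P \<union> M"
    show "gpair (\<alpha> a b) c + gpair (\<alpha> b c) a + gpair (\<alpha> c a) b = 0"
    proof (cases "a \<in> M \<or> b \<in> M \<or> c \<in> M")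
      case True
      then show ?thesis by (auto simp: zero_frame orth gpair_left)
    next
      case False
      then show ?thesis
        using cyc_P[of a b c] abc by (simp add: span_base)
    qed
  qed (intro linear_compose_add lin linear_gpair)+
  have P: "\<alpha> u v \<in> span P" for u v
    by (rule in_span_P) (rule orth)
  have bil': "bilinear (\<lambda>u v. D u v + \<alpha> u v)"
    using bil by (simp add: bilinear_def linear_compose_add)
  have "torsion br H (\<lambda>u v. D u v + \<alpha> u v) u v = 0" for u v
    unfolding torsion_eq_0_iff[OF bil']
  proof
    fix w
    show "gpair (dorfman br H u v) w = gpair (D u v + \<alpha> u v) w - gpair (D v u + \<alpha> v u) w
        + gpair (D w u + \<alpha> w u) v"
      using gpair_dorfman_torsion_free[OF D, of u v w] cyc[of u v w] skew[of v u w]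
      by (simp add: gpair_left)
  qed
  moreover have "gpair (D u v + \<alpha> u v) w + gpair v (D u w + \<alpha> u w) = 0" for u v w
    using split_levi_civitaD(2)[OF D, of u v w] skew[of u v w]
    by (simp add: gpair_left gpair_right gpair_sym[of v "\<alpha> u w"])
  moreover have "D u v + \<alpha> u v \<in> span P" if "v \<in> span P" for u v
    using that by (intro span_add P split_levi_civitaD(4)[OF D])
  moreover have "D u v + \<alpha> u v \<in> span M" if "v \<in> span M" for u v
    using that split_levi_civitaD(5)[OF D] by (simp add: zero)
  ultimately show "split_levi_civita br H (span P) (span M) (\<lambda>u v. D u v + \<alpha> u v)"
    unfolding split_levi_civita_def gen_connection_def
    by (intro conjI allI image_subsetI bil')
qed

end

theorem proposition2p24:
  fixes br :: "'a::real_vector \<Rightarrow> 'a \<Rightarrow> 'a"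
    and H :: "'a \<Rightarrow> 'a \<Rightarrow> 'a \<Rightarrow> real"
    and g :: "'a \<Rightarrow> 'a \<Rightarrow> real"
    and D0 S :: "'a gspace \<Rightarrow> 'a gspace \<Rightarrow> 'a gspace"
    and \<delta> :: "'a gspace \<Rightarrow> real"
  assumes "finite_dimensional TYPE('a)"
    and "lie_algebra br"
    and "three_form H" and "closed_form3 br H"
    and "pseudo_metric g"
    and "canonical_connection br H g D0"
    and "linear \<delta>"
    and "S \<in> gen_prolongation g"
    and "divergence (\<lambda>u v. D0 u v + S u v) = \<delta>"
  shows "(\<forall>u\<in>E_minus g. \<forall>v\<in>E_plus g.
            Ric_plus br H g \<delta> u v
              = Ric_plus br H g (\<lambda>_. 0) u v + trace_on (E_plus g) (\<lambda>w. d_conn br H D0 S w u v) \<and>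
            Ric_plus br H g (\<lambda>_. 0) u v + trace_on (E_plus g) (\<lambda>w. d_conn br H D0 S w u v)
              = Ric_plus br H g (\<lambda>_. 0) u v - cov_deriv_form D0 \<delta> u v) \<and>
         (\<forall>u\<in>E_plus g. \<forall>v\<in>E_minus g.
            Ric_minus br H g \<delta> u v
              = Ric_minus br H g (\<lambda>_. 0) u v + trace_on (E_minus g) (\<lambda>w. d_conn br H D0 S w u v) \<and>
            Ric_minus br H g (\<lambda>_. 0) u v + trace_on (E_minus g) (\<lambda>w. d_conn br H D0 S w u v)
              = Ric_minus br H g (\<lambda>_. 0) u v - cov_deriv_form D0 \<delta> u v)"
proof -
  obtain B where B: "orthonormal_basis g B" and bil0: "bilinear D0"
    and coeff: "let P = (\<lambda>v. (v, flat g v)) ` B; M = (\<lambda>v. (v, - flat g v)) ` B in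
        \<forall>a\<in>P \<union> M. \<forall>b\<in>P \<union> M. \<forall>c\<in>P \<union> M.
          gpair (D0 a b) c = canonical_coeff br H P M a b c"
    using assms(6) unfolding canonical_connection_def by blast
  define P where "P = (\<lambda>v. (v, flat g v)) ` B"
  define M where "M = (\<lambda>v. (v, - flat g v)) ` B"
  note split = orthonormal_basis_splitting[OF assms(1,5) B, folded P_def M_def]
  interpret orthogonal_splitting P M by (rule split(1))
  interpret sw: orthogonal_splitting M P by (rule swap)
  have Ep: "E_plus g = span P" and Em: "E_minus g = span M" by (rule split)+
  have lc_iff: "levi_civita br H g D \<longleftrightarrow> split_levi_civita br H (span P) (span M) D" for D
    by (simp add: levi_civita_def split_levi_civita_def Ep Em)
  have coeff': "gpair (D0 a b) c = canonical_coeff br H P M a b c"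
    if "a \<in> P \<union> M" "b \<in> P \<union> M" "c \<in> P \<union> M" for a b c
    using coeff that unfolding Let_def P_def M_def by blast
  note D0 = canonical_levi_civita[OF assms(2,3) bil0 coeff']
  obtain \<alpha> \<beta> where S: "S = (\<lambda>u v. \<alpha> u v + \<beta> u v)"
    and \<alpha>: "\<alpha> \<in> prolongation_on (span P) (span M)" and \<beta>: "\<beta> \<in> prolongation_on (span M) (span P)"
    using assms(8) unfolding gen_prolongation_def Ep Em by blast
  note swapI = split_levi_civita_swap[THEN iffD1]
  \<comment> \<open>The two blocks of \<open>S\<close> are added in turn, the second one after
    exchanging E_+ and E_-.\<close>
  have "split_levi_civita br H (span P) (span M) (\<lambda>u v. D0 u v + \<alpha> u v + \<beta> u v)"
    by (rule swapI[OF sw.levi_civita_add_prolongation[OF swapI[OF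
              levi_civita_add_prolongation[OF D0(1) \<alpha>]] \<beta>]])
  then have DS: "split_levi_civita br H (span P) (span M) (\<lambda>u v. D0 u v + S u v)"
    by (simp add: S add.assoc)
  have blockS: "block_diagonal (span P) (span M) S"
    using block_diagonal_difference[OF D0(1) DS] by simp
  \<comment> \<open>\<open>D0\<close> is divergence-free, so \<open>S\<close> alone carries
    \<delta>.\<close>
  have divS: "divergence S v = \<delta> v" for v
  proof -
    have "divergence (\<lambda>u v. D0 u v + S u v) v = divergence D0 v + divergence S v"
      unfolding divergence_def
      by (rule trace_on_add[OF orthogonal_frame_independent[OF frame] spanning]) auto
    then show ?thesis using assms(9) D0(2) by simp
  qed
  \<comment> \<open>The choice in \<open>lc_with_div\<close> needs a witness: this will be
    \<open>D0 + S\<close> for \<delta> and \<open>D0\<close> for divergence zero.\<close>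
  have lc: "split_levi_civita br H (span P) (span M) (lc_with_div br H g \<delta>')
      \<and> divergence (lc_with_div br H g \<delta>') = \<delta>'"
    if "split_levi_civita br H (span P) (span M) D" "divergence D = \<delta>'" for D \<delta>'
    unfolding lc_with_div_def lc_iff by (rule someI[where x = D]) (use that in blast)
  note lc_\<delta> = lc[OF DS assms(9)]
  have "divergence D0 = (\<lambda>_. 0)" using D0(2) by blast
  note lc_0 = lc[OF D0(1) this]
  show ?thesis
    unfolding Ric_plus_def Ric_minus_def cov_deriv_form_def Ep Em
  proof (intro conjI ballI)
    fix u v assume uv: "u \<in> span M" "v \<in> span P"
    \<comment> \<open>\<open>R(1)\<close> compares each selected connection with \<open>D0\<close>.
      Subtracting its two instances gives Ric_\<delta> - Ric_0 = \<open>\<delta> (D0 u v)\<close>,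
      which by \<open>R(2)\<close> is the trace of \<open>d_conn\<close>.\<close>
    note R = ricci_variation[OF D0(1) _ uv] trace_d_conn[OF D0(1) blockS uv]
    show "trace_on (span P) (\<lambda>w. curvature br H (lc_with_div br H g \<delta>) w u v)
        = trace_on (span P) (\<lambda>w. curvature br H (lc_with_div br H g (\<lambda>_. 0)) w u v)
          + trace_on (span P) (\<lambda>w. d_conn br H D0 S w u v)"
      using R(1)[of "lc_with_div br H g \<delta>"] R(1)[of "lc_with_div br H g (\<lambda>_. 0)"] R(2)
        lc_\<delta> lc_0 D0(2) divS by simp
    \<comment> \<open>One minus sign belongs to the claim and one to \<open>cov_deriv_form\<close>;
      both sides add \<open>\<delta> (D0 u v)\<close>.\<close>
    show "trace_on (span P) (\<lambda>w. curvature br H (lc_with_div br H g (\<lambda>_. 0)) w u v)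
          + trace_on (span P) (\<lambda>w. d_conn br H D0 S w u v)
        = trace_on (span P) (\<lambda>w. curvature br H (lc_with_div br H g (\<lambda>_. 0)) w u v)
          - - \<delta> (D0 u v)"
      using R(2) divS by simp
  next
    \<comment> \<open>The same argument in the exchanged splitting.\<close>
    fix u v assume uv: "u \<in> span P" "v \<in> span M"
    note R = sw.ricci_variation[OF swapI[OF D0(1)] swapI uv]
      sw.trace_d_conn[OF swapI[OF D0(1)] block_diagonal_swap[THEN iffD1, OF blockS] uv]
    show "trace_on (span M) (\<lambda>w. curvature br H (lc_with_div br H g \<delta>) w u v)
        = trace_on (span M) (\<lambda>w. curvature br H (lc_with_div br H g (\<lambda>_. 0)) w u v)
          + trace_on (span M) (\<lambda>w. d_conn br H D0 S w u v)"
      using R(1)[of "lc_with_div br H g \<delta>"] R(1)[of "lc_with_div br H g (\<lambda>_. 0)"] R(2)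
        lc_\<delta> lc_0 D0(2) divS by simp
    show "trace_on (span M) (\<lambda>w. curvature br H (lc_with_div br H g (\<lambda>_. 0)) w u v)
          + trace_on (span M) (\<lambda>w. d_conn br H D0 S w u v)
        = trace_on (span M) (\<lambda>w. curvature br H (lc_with_div br H g (\<lambda>_. 0)) w u v)
          - - \<delta> (D0 u v)"
      using R(2) divS by simp
  qed
qed

end
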